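(* Consider four particles of mass $1$ in $\mathbb{R}^2$ moving according to $\ddot q_i=\partial U/\partial q_i$, $i=1,2,3,4$, with the Schwarzschild potential $U(q_1,\dots,q_4)=\sum_{1\le i<j\le 4}\left(\frac{1}{\|q_i-q_j\|}+\frac{1}{\|q_i-q_j\|^3}\right)$. Let $z_0=(1,0,0,1,-1,0,0,-1)^T\in\mathbb{R}^8$ be the vertices of the square inscribed in the unit circle, and let $\omega>0$ be the angular velocity for which the uniform rotation of $z_0$ about the origin is a solution, namely $\omega^2=\frac{7}{16}+\frac{5}{2\sqrt2}$. Then the corresponding relative equilibrium is (linearly) unstable: the linearized system at it has an eigenvalue with positive real part.
   Context: A configuration $z=(a_1,\dots,a_n)\in(\mathbb{R}^2)^n$ together with $\omega>0$ defines a relative equilibrium if $q_i(t)=\exp(-\omega Jt)a_i$, where $J=\begin{pmatrix}0&1\\-1&0\end{pmatrix}$ and hence $\exp(-\omega Jt)=\begin{pmatrix}\cos\omega t&-\sin\omega t\\ \sin\omega t&\cos\omega t\end{pmatrix}$, solves the equations of motion. In the rotating coordinates $q_i=\exp(-\omega Jt)x_i$ the equations become $\ddot x_i=2\omega J\dot x_i+\omega^2x_i+\nabla_{x_i}U$ (unit masses), and the relative equilibrium becomes the equilibrium $x=z$. The linearized system at it is $\ddot X=2\omega\mathbf{J}\dot X+\omega^2X+D^2U(z)X$ for $X\in\mathbb{R}^{2n}$, where $\mathbf{J}=\mathrm{diag}(J,\dots,J)$ ($n$ blocks) and $D^2U(z)$ is the Hessian of $U$ at $z$. Its eigenvalues are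 those of the $4n\times4n$ matrix $\begin{pmatrix}0&I_{2n}\\ \omega^2I_{2n}+D^2U(z)&2\omega\mathbf{J}\end{pmatrix}$. The relative equilibrium is called (linearly) unstable if this matrix has an eigenvalue with positive real part. *)

theory Defs
  imports "HOL-Analysis.Analysis"
begin

text \<open>
  Configurations of particles in the plane, indexed by a finite type \<open>'n\<close>, are elements of
  \<open>real^2^'n\<close>. The coordinates of the configuration space are indexed by pairs \<open>(i, k)\<close>
  (particle, component), so that \<open>2n \<times> 2n\<close> matrices have type \<open>real^('n \<times> 2)^('n \<times> 2)\<close>.
\<close>

definition solves_motion :: "(real^2^'n \<Rightarrow> real) \<Rightarrow> (real \<Rightarrow> real^2^'n) \<Rightarrow> bool" where
  "solves_motion U q \<longleftrightarrow>
     (\<exists>v a. \<forall>t. (q has_vector_derivative v t) (at t) \<and>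
                (v has_vector_derivative a t) (at t) \<and>
                GDERIV U (q t) :> a t)"

definition J_mat :: "real^2^2" where
  "J_mat = vector [vector [0, 1], vector [-1, 0]]"

text \<open>\<open>rotation \<theta>\<close> is the matrix exponential of \<open>- \<theta> J\<close>.\<close>

definition rotation :: "real \<Rightarrow> real^2^2" where
  "rotation \<theta> = vector [vector [cos \<theta>, - sin \<theta>], vector [sin \<theta>, cos \<theta>]]"

definition relative_equilibrium :: "(real^2^'n \<Rightarrow> real) \<Rightarrow> real^2^'n \<Rightarrow> real \<Rightarrow> bool" where
  "relative_equilibrium U z \<omega> \<longleftrightarrow>
     \<omega> > 0 \<and> solves_motion U (\<lambda>t. \<chi> i. rotation (\<omega> * t) *v (z $ i))"

definition partial_deriv :: "'n \<times> 2 \<Rightarrow> (real^2^'n \<Rightarrow> real) \<Rightarrow> real^2^'n \<Rightarrow> real" where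
  "partial_deriv p f x = deriv (\<lambda>s. f (x + s *\<^sub>R axis (fst p) (axis (snd p) 1))) 0"

definition hessian :: "(real^2^'n \<Rightarrow> real) \<Rightarrow> real^2^'n \<Rightarrow> real^('n \<times> 2)^('n \<times> 2)" where
  "hessian f x = (\<chi> p q. partial_deriv p (partial_deriv q f) x)"

definition J_diag :: "real^('n::finite \<times> 2)^('n \<times> 2)" where
  "J_diag = (\<chi> p q. if fst p = fst q then J_mat $ snd p $ snd q else 0)"

definition block_matrix ::
  "'a^'m^'m \<Rightarrow> 'a^'m^'m \<Rightarrow> 'a^'m^'m \<Rightarrow> 'a^'m^'m \<Rightarrow> 'a^('m::finite + 'm)^('m + 'm)" where
  "block_matrix A B C D = (\<chi> r s.
     case r of
       Inl i \<Rightarrow> (case s of Inl j \<Rightarrow> A $ i $ j | Inr j \<Rightarrow> B $ i $ j)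
     | Inr i \<Rightarrow> (case s of Inl j \<Rightarrow> C $ i $ j | Inr j \<Rightarrow> D $ i $ j))"

definition linearization ::
  "(real^2^'n \<Rightarrow> real) \<Rightarrow> real^2^'n \<Rightarrow> real \<Rightarrow>
     real^('n \<times> 2 + 'n \<times> 2)^('n \<times> 2 + 'n \<times> 2)" where
  "linearization U z \<omega> =
     block_matrix 0 (mat 1) (mat (\<omega>\<^sup>2) + hessian U z) ((2 * \<omega>) *\<^sub>R J_diag)"

definition is_eigenvalue :: "complex^'m^'m \<Rightarrow> complex \<Rightarrow> bool" where
  "is_eigenvalue A \<mu> \<longleftrightarrow> (\<exists>v. v \<noteq> 0 \<and> A *v v = \<mu> *s v)"

definition linearly_unstable :: "(real^2^'n \<Rightarrow> real) \<Rightarrow> real^2^'n \<Rightarrow> real \<Rightarrow> bool" where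
  "linearly_unstable U z \<omega> \<longleftrightarrow>
     (\<exists>\<mu>. is_eigenvalue (map_matrix complex_of_real (linearization U z \<omega>)) \<mu> \<and> Re \<mu> > 0)"

text \<open>
  The order on the index type \<open>4\<close> only serves to select every unordered pair of particles once.
\<close>

definition schwarzschild_potential :: "real^2^4 \<Rightarrow> real" where
  "schwarzschild_potential q =
     (\<Sum>(i, j) \<in> {(i, j). i < j}.
        1 / norm (q $ i - q $ j) + 1 / norm (q $ i - q $ j) ^ 3)"

definition square_configuration :: "real^2^4" where
  "square_configuration =
     vector [vector [1, 0], vector [0, 1], vector [-1, 0], vector [0, -1]]"

end

theory Submission
  imports Defs
begin

text \<open>
  The instability is caused by the homothetic mode. Let \<open>z\<close> be the square and \<open>Jz\<close> its rotation by
  a right angle. The Hessian preserves the plane spanned by \<open>z\<close> and \<open>Jz\<close>: it maps \<open>z\<close> to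
  \<open>h z\<close> with \<open>h = 5/4 + 4 sqrt 2\<close> by the symmetry of the square, and \<open>Jz\<close> to \<open>- \<omega>\<^sup>2 Jz\<close>
  by the rotation invariance of the potential. On this plane the eigenvalue equation
  \<open>\<mu>\<^sup>2 Y = 2 \<omega> \<mu> JY + \<omega>\<^sup>2 Y + D\<^sup>2U(z) Y\<close> is solved by \<open>Y = \<mu> z + 2 \<omega> Jz\<close> with
  \<open>\<mu>\<^sup>2 = h - 3 \<omega>\<^sup>2 = sqrt 2 / 4 - 1 / 16 > 0\<close>.
\<close>

section \<open>Derivatives of norm powers, sums over pairs, and Hessians\<close>

text \<open>Chain rule through the norm, whose derivative in direction \<open>h\<close> is
  \<open>h \<bullet> w / norm w\<close>. This extra division turns the exponent \<open>n + 1\<close>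
  of the one-variable derivative into \<open>n + 2\<close>.\<close>

lemma has_derivative_inverse_norm_power:
  fixes w :: "'a::real_inner"
  assumes "w \<noteq> 0"
  shows "((\<lambda>w. 1 / norm w ^ n) has_derivative
           (\<lambda>h. - (of_nat n / norm w ^ (n + 2)) * (h \<bullet> w))) (at w)"
proof -
  have "((\<lambda>u::real. inverse u ^ n) has_derivative
          (*) (- (of_nat n / norm w ^ Suc n))) (at (norm w))"
    unfolding has_field_derivative_def[symmetric]
  proof (rule DERIV_cong[OF DERIV_power[OF DERIV_inverse]])
    show "of_nat n * (- (inverse (norm w) ^ Suc (Suc 0)) * inverse (norm w) ^ (n - Suc 0)) =
        - (of_nat n / norm w ^ Suc n)"
      \<comment> \<open>The case distinction handles the truncated subtraction
        \<open>n - Suc 0\<close> in the power rule at \<open>n = 0\<close>.\<close>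
      using assms by (cases n) (simp_all add: field_simps)
  qed (use assms in simp)
  from has_derivative_compose[OF has_derivative_norm[OF assms] this]
  show ?thesis using assms by (simp add: sgn_div_norm field_simps power_one_over)
qed

text \<open>The index square splits into the two triangles and the diagonal; the swap maps one
  triangle onto the other, and the diagonal contributes 0. This turns the potential's sum over
  unordered pairs into a sum of forces over each particle.\<close>

lemma sum_unordered_pairs:
  fixes F :: "'n::{finite,linorder} \<Rightarrow> 'n \<Rightarrow> 'a::comm_monoid_add"
  assumes "\<And>i. F i i = 0"
  shows "(\<Sum>(i, j)\<in>{(i, j). i < j}. F i j + F j i) = (\<Sum>i\<in>UNIV. \<Sum>j\<in>UNIV. F i j)"
proof -
  let ?L = "{(i, j). i < j} :: ('n \<times> 'n) set"
  let ?G = "{(i, j). j < i} :: ('n \<times> 'n) set"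
  let ?D = "{(i, j). i = j} :: ('n \<times> 'n) set"
  have "(\<Sum>i\<in>UNIV. \<Sum>j\<in>UNIV. F i j) = (\<Sum>(i, j)\<in>UNIV. F i j)"
    by (simp add: sum.cartesian_product)
  also have "(UNIV :: ('n \<times> 'n) set) = (?L \<union> ?G) \<union> ?D"
    by auto
  also have "(\<Sum>(i, j)\<in>(?L \<union> ?G) \<union> ?D. F i j) =
      (\<Sum>(i, j)\<in>?L. F i j) + (\<Sum>(i, j)\<in>?G. F i j) + (\<Sum>(i, j)\<in>?D. F i j)"
    by (subst sum.union_disjoint, simp, simp, force)+ simp
  also have "(\<Sum>(i, j)\<in>?D. F i j) = 0"
    by (rule sum.neutral) (auto simp: assms)
  also have "(\<Sum>(i, j)\<in>?G. F i j) = (\<Sum>(i, j)\<in>?L. F j i)"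
    by (rule sum.reindex_bij_witness[of _ prod.swap prod.swap]) auto
  finally show ?thesis
    unfolding add_0_right sum.distrib[symmetric] by (simp add: case_prod_unfold)
qed

lemma partial_deriv_eq:
  fixes f :: "real^2^'n \<Rightarrow> real"
  assumes "(f has_derivative f') (at x)"
  shows "partial_deriv p f x = f' (axis (fst p) (axis (snd p) 1))"
proof -
  let ?e = "axis (fst p) (axis (snd p) 1) :: real^2^'n"
  interpret f': bounded_linear f'
    using assms by (rule has_derivative_bounded_linear)
  have "((\<lambda>s. x + s *\<^sub>R ?e) has_derivative (\<lambda>s. s *\<^sub>R ?e)) (at 0)"
    by (auto intro!: derivative_eq_intros)
  from has_derivative_compose[OF this, of f f'] assms
  have "((\<lambda>s. f (x + s *\<^sub>R ?e)) has_derivative (\<lambda>s. f' (s *\<^sub>R ?e))) (at 0)"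
    by simp
  also have "(\<lambda>s. f' (s *\<^sub>R ?e)) = (*) (f' ?e)"
    by (simp add: f'.scaleR mult.commute fun_eq_iff)
  finally show ?thesis
    unfolding partial_deriv_def has_field_derivative_def[symmetric] by (rule DERIV_imp_deriv)
qed

text \<open>The gradient is required on a whole open set because the inner partial derivative is
  differentiated once more: on \<open>S\<close> it coincides with a component of \<open>g\<close>
  and so inherits the derivative of that component.\<close>

lemma hessian_eq:
  fixes f :: "real^2^'n \<Rightarrow> real"
  assumes S: "open S" "x \<in> S"
    and grad: "\<And>y. y \<in> S \<Longrightarrow> GDERIV f y :> g y"
    and deriv: "(g has_derivative g') (at x)"
  shows "hessian f x $ p $ q = g' (axis (fst p) (axis (snd p) 1)) $ fst q $ snd q"
proof -
  have "((\<lambda>y. g y $ fst q $ snd q) has_derivative (\<lambda>h. g' h $ fst q $ snd q)) (at x)"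
    by (intro bounded_linear.has_derivative[OF bounded_linear_vec_nth] deriv)
  moreover have "g y $ fst q $ snd q = partial_deriv q f y" if "y \<in> S" for y
    using grad[OF that] unfolding gderiv_def
    by (simp add: partial_deriv_eq inner_commute[of _ "g y"] inner_axis)
  ultimately have "(partial_deriv q f has_derivative (\<lambda>h. g' h $ fst q $ snd q)) (at x)"
    using S has_derivative_transform_within_open by blast
  then show ?thesis
    by (simp add: hessian_def partial_deriv_eq)
qed

section \<open>Eigenvalues of the linearization\<close>

lemma is_eigenvalue_of_real:
  fixes A :: "real^'m^'m"
  assumes "v \<noteq> 0" "A *v v = \<mu> *s v"
  shows "is_eigenvalue (map_matrix complex_of_real A) (complex_of_real \<mu>)"
  unfolding is_eigenvalue_def
proof (intro exI conjI)
  let ?v = "\<chi> i. complex_of_real (v $ i)"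
  show "?v \<noteq> 0"
    using assms(1) by (auto simp: vec_eq_iff)
  show "map_matrix complex_of_real A *v ?v = complex_of_real \<mu> *s ?v"
    using assms(2)
    by (auto simp: vec_eq_iff matrix_vector_mult_def map_matrix_def
        simp flip: of_real_mult of_real_sum)
qed

text \<open>The first-order system encodes a quadratic eigenvalue problem: \<open>eq\<close> says
  that \<open>Y\<close> solves it, where \<open>D\<close> is the Hessian applied to
  \<open>Y\<close>, and then the pair of \<open>Y\<close> and \<open>\<mu> *\<^sub>R Y\<close> is an
  eigenvector of the block matrix.\<close>

lemma linearization_eigenvalue:
  fixes Y D :: "real^2^'n"
  assumes "Y \<noteq> 0"
    and hess: "\<And>p. (\<Sum>q\<in>UNIV. hessian U z $ p $ q * Y $ fst q $ snd q) = D $ fst p $ snd p"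
    and eq: "\<And>i. \<mu>\<^sup>2 *\<^sub>R Y $ i = (2 * \<omega> * \<mu>) *\<^sub>R (J_mat *v Y $ i) + \<omega>\<^sup>2 *\<^sub>R Y $ i + D $ i"
  shows "is_eigenvalue (map_matrix complex_of_real (linearization U z \<omega>)) (complex_of_real \<mu>)"
proof (rule is_eigenvalue_of_real)
  define X :: "'n \<times> 2 \<Rightarrow> real" where "X = (\<lambda>p. Y $ fst p $ snd p)"
  define V :: "real^('n \<times> 2 + 'n \<times> 2)"
    where "V = (\<chi> r. case r of Inl p \<Rightarrow> X p | Inr p \<Rightarrow> \<mu> * X p)"
  have J: "(\<Sum>q\<in>UNIV. J_diag $ p $ q * X q) = (J_mat *v Y $ fst p) $ snd p" for p :: "'n \<times> 2"
  proof -
    have "(\<Sum>q\<in>UNIV. J_diag $ p $ q * X q) =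
        (\<Sum>i\<in>UNIV. \<Sum>k\<in>UNIV. (J_diag $ p $ (i, k)) * X (i, k))"
      by (simp add: sum.cartesian_product)
    also have "\<dots> = (\<Sum>i\<in>UNIV. if fst p = i then (J_mat *v Y $ fst p) $ snd p else 0)"
      by (rule sum.cong) (auto simp: J_diag_def X_def matrix_vector_mult_def)
    finally show ?thesis by simp
  qed
  show "V \<noteq> 0"
  proof
    assume "V = 0"
    then have "V $ Inl (i, k) = 0" for i k by simp
    then have "Y = 0" by (simp add: V_def X_def vec_eq_iff)
    with assms(1) show False ..
  qed
  \<comment> \<open>The upper block row only expresses that velocity is \<open>\<mu>\<close> times
    position.\<close>
  have upper: "(linearization U z \<omega> *v V) $ Inl p = \<mu> * V $ Inl p" for p
  proof -
    have "(linearization U z \<omega> *v V) $ Inl p = (\<Sum>q\<in>UNIV. mat 1 $ p $ q * (\<mu> * X q))"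
      by (simp add: linearization_def block_matrix_def matrix_vector_mult_def V_def
          UNIV_Plus_UNIV[symmetric] sum.Plus del: UNIV_Plus_UNIV)
    also have "\<dots> = (\<Sum>q\<in>UNIV. if p = q then \<mu> * X q else 0)"
      by (rule sum.cong) (auto simp: mat_def)
    finally show ?thesis by (simp add: V_def)
  qed
  \<comment> \<open>The lower block row is the quadratic equation \<open>eq\<close>.\<close>
  have lower: "(linearization U z \<omega> *v V) $ Inr p = \<mu> * V $ Inr p" for p
  proof -
    have "(linearization U z \<omega> *v V) $ Inr p =
        (\<Sum>q\<in>UNIV. (mat (\<omega>\<^sup>2) $ p $ q + hessian U z $ p $ q) * X q) +
        (\<Sum>q\<in>UNIV. 2 * \<omega> * J_diag $ p $ q * (\<mu> * X q))"
      by (simp add: linearization_def block_matrix_def matrix_vector_mult_def V_def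
          UNIV_Plus_UNIV[symmetric] sum.Plus del: UNIV_Plus_UNIV)
    also have "(\<Sum>q\<in>UNIV. 2 * \<omega> * J_diag $ p $ q * (\<mu> * X q)) =
        2 * \<omega> * \<mu> * (\<Sum>q\<in>UNIV. J_diag $ p $ q * X q)"
      by (simp add: sum_distrib_left mult_ac)
    also have "(\<Sum>q\<in>UNIV. (mat (\<omega>\<^sup>2) $ p $ q + hessian U z $ p $ q) * X q) =
        (\<Sum>q\<in>UNIV. if p = q then \<omega>\<^sup>2 * X q else 0) + (\<Sum>q\<in>UNIV. hessian U z $ p $ q * X q)"
      unfolding sum.distrib[symmetric]
      by (rule sum.cong) (auto simp: mat_def algebra_simps)
    finally have "(linearization U z \<omega> *v V) $ Inr p =
        \<omega>\<^sup>2 * X p + D $ fst p $ snd p + 2 * \<omega> * \<mu> * (J_mat *v Y $ fst p) $ snd p"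
      using hess[of p] J[of p] by (simp add: X_def)
    also have "\<dots> = ((2 * \<omega> * \<mu>) *\<^sub>R (J_mat *v Y $ fst p) + \<omega>\<^sup>2 *\<^sub>R Y $ fst p + D $ fst p) $ snd p"
      by (simp add: X_def)
    also have "\<dots> = \<mu>\<^sup>2 * X p"
      unfolding eq[symmetric] by (simp add: X_def)
    finally show ?thesis
      by (simp add: V_def power2_eq_square)
  qed
  show "linearization U z \<omega> *v V = \<mu> *s V"
    unfolding vec_eq_iff
  proof
    fix r show "(linearization U z \<omega> *v V) $ r = (\<mu> *s V) $ r"
      by (cases r) (simp_all add: upper lower)
  qed
qed

section \<open>Gradient and Hessian of the potential\<close>

text \<open>For \<open>w \<noteq> 0\<close> this is the gradient of the pair potential 1/r + 1/r^3
  with r = \<open>norm w\<close>.\<close>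

definition pair_force :: "'a::real_inner \<Rightarrow> 'a" where
  "pair_force w = - (1 / norm w ^ 3 + 3 / norm w ^ 5) *\<^sub>R w"

text \<open>Written as a rank-one radial part minus a multiple of the identity: symmetry is then
  visible, and radial and tangential directions \<open>h\<close> are easy to evaluate.\<close>

definition pair_force_deriv :: "'a::real_inner \<Rightarrow> 'a \<Rightarrow> 'a" where
  "pair_force_deriv w h =
     ((3 / norm w ^ 5 + 15 / norm w ^ 7) * (h \<bullet> w)) *\<^sub>R w - (1 / norm w ^ 3 + 3 / norm w ^ 5) *\<^sub>R h"

lemma pair_force_minus: "pair_force (- w) = - pair_force w"
  by (simp add: pair_force_def)

lemma pair_force_deriv_minus: "pair_force_deriv (- w) (- h) = - pair_force_deriv w h"
  by (simp add: pair_force_deriv_def)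

lemma pair_force_zero: "pair_force 0 = 0"
  by (simp add: pair_force_def)

lemma pair_potential_has_derivative:
  assumes "w \<noteq> 0"
  shows "((\<lambda>w. 1 / norm w + 1 / norm w ^ 3) has_derivative (\<lambda>h. h \<bullet> pair_force w)) (at w)"
  using has_derivative_add[OF has_derivative_inverse_norm_power[OF assms, of 1]
      has_derivative_inverse_norm_power[OF assms, of 3]]
  by (simp add: pair_force_def algebra_simps power3_eq_cube)

lemma pair_force_has_derivative:
  assumes "w \<noteq> 0"
  shows "(pair_force has_derivative pair_force_deriv w) (at w)"
proof -
  \<comment> \<open>The factor 3 is pulled out so that both summands match
    \<open>has_derivative_inverse_norm_power\<close>.\<close>
  have "((\<lambda>w. - (1 / norm w ^ 3 + 3 * (1 / norm w ^ 5)) *\<^sub>R w) has_derivative pair_force_deriv w) (at w)"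
    by (rule derivative_eq_intros has_derivative_inverse_norm_power[OF assms] refl)+
      (simp add: fun_eq_iff pair_force_deriv_def algebra_simps)
  then show ?thesis
    by (simp add: pair_force_def[abs_def])
qed

text \<open>The summand \<open>j = i\<close> vanishes because of \<open>1 / 0 = 0\<close>.\<close>

definition force :: "real^2^'n \<Rightarrow> real^2^'n" where
  "force x = (\<chi> i. \<Sum>j\<in>UNIV. pair_force (x $ i - x $ j))"

definition force_deriv :: "real^2^'n \<Rightarrow> real^2^'n \<Rightarrow> real^2^'n" where
  "force_deriv x h = (\<chi> i. \<Sum>j\<in>UNIV. pair_force_deriv (x $ i - x $ j) (h $ i - h $ j))"

text \<open>Each pair pushes its two particles with opposite forces since \<open>pair_force\<close>
  is odd. Hence the derivative, a sum over pairs, regroups into one total force per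
  particle.\<close>

lemma schwarzschild_potential_GDERIV:
  assumes "inj (($) x)"
  shows "GDERIV schwarzschild_potential x :> force x"
proof -
  have pair: "((\<lambda>x. 1 / norm (x $ i - x $ j) + 1 / norm (x $ i - x $ j) ^ 3) has_derivative
      (\<lambda>h. (h $ i - h $ j) \<bullet> pair_force (x $ i - x $ j))) (at x)" if "i < j" for i j
  proof -
    have "x $ i - x $ j \<noteq> 0"
      using assms that by (auto simp: inj_def)
    moreover have "((\<lambda>x. x $ i - x $ j) has_derivative (\<lambda>h. h $ i - h $ j)) (at x)"
      by (intro has_derivative_diff bounded_linear_imp_has_derivative bounded_linear_vec_nth)
    ultimately show ?thesis
      using has_derivative_compose pair_potential_has_derivative by blast
  qed
  have "(schwarzschild_potential has_derivative
      (\<lambda>h. \<Sum>(i, j)\<in>{(i, j). i < j}. (h $ i - h $ j) \<bullet> pair_force (x $ i - x $ j))) (at x)"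
    unfolding schwarzschild_potential_def[abs_def] case_prod_beta
    by (rule has_derivative_sum) (auto intro: pair)
  moreover have "(\<Sum>(i, j)\<in>{(i, j). i < j}. (h $ i - h $ j) \<bullet> pair_force (x $ i - x $ j)) =
      h \<bullet> force x" for h
  proof -
    have "(h $ i - h $ j) \<bullet> pair_force (x $ i - x $ j) =
        h $ i \<bullet> pair_force (x $ i - x $ j) + h $ j \<bullet> pair_force (x $ j - x $ i)" for i j
      using pair_force_minus[of "x $ i - x $ j"] by (simp add: inner_diff_left)
    then show ?thesis
      using sum_unordered_pairs[of "\<lambda>i j. h $ i \<bullet> pair_force (x $ i - x $ j)"]
      by (simp add: pair_force_zero force_def inner_vec_def[of h] inner_sum_right)
  qed
  ultimately show ?thesis
    by (simp add: gderiv_def)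
qed

lemma open_collision_free: "open {x :: 'a::real_normed_vector^'n. inj (($) x)}"
proof -
  have "{x :: 'a^'n. inj (($) x)} = (\<Inter>i. \<Inter>j\<in>- {i}. {x. x $ i \<noteq> x $ j})"
    by (auto simp: inj_def)
  moreover have "open {x :: 'a^'n. x $ i \<noteq> x $ j}" for i j
    by (intro open_Collect_neq continuous_intros)
  ultimately show ?thesis by (auto intro!: open_INT)
qed

lemma force_has_derivative:
  assumes "inj (($) x)"
  shows "(force has_derivative force_deriv x) (at x)"
proof -
  have pair: "((\<lambda>x. pair_force (x $ i - x $ j)) has_derivative
      (\<lambda>h. pair_force_deriv (x $ i - x $ j) (h $ i - h $ j))) (at x)" for i j
  proof (cases "i = j")
    case True
    \<comment> \<open>The difference is identically 0 here, so the summand is constant in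
      \<open>x\<close> and its derivative is 0.\<close>
    then show ?thesis by (simp add: pair_force_deriv_def)
  next
    case False
    then have "x $ i - x $ j \<noteq> 0"
      using assms by (auto simp: inj_def)
    moreover have "((\<lambda>x. x $ i - x $ j) has_derivative (\<lambda>h. h $ i - h $ j)) (at x)"
      by (intro has_derivative_diff bounded_linear_imp_has_derivative bounded_linear_vec_nth)
    ultimately show ?thesis
      using has_derivative_compose pair_force_has_derivative by blast
  qed
  show ?thesis
    unfolding force_def[abs_def] force_deriv_def[abs_def]
    by (subst has_derivative_componentwise_within)
      (auto simp: Basis_vec_def inner_axis
        intro!: has_derivative_sum bounded_linear.has_derivative[OF bounded_linear_vec_nth pair])
qed

text \<open>Averaging the double sum with its copy under exchange of \<open>i\<close> and
  \<open>j\<close> makes the form depend on \<open>a\<close> and \<open>b\<close> only through the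
  differences \<open>a $ i - a $ j\<close> and \<open>b $ i - b $ j\<close>; symmetry then reduces
  to that of each \<open>pair_force_deriv w\<close>.\<close>

lemma force_deriv_symmetric:
  fixes h k :: "real^2^'n"
  shows "force_deriv x h \<bullet> k = h \<bullet> force_deriv x k"
proof -
  let ?P = "\<lambda>i j. pair_force_deriv (x $ i - x $ j)"
  have pair: "pair_force_deriv w a \<bullet> b = pair_force_deriv w b \<bullet> a" for w a b :: "real^2"
    by (simp add: pair_force_deriv_def inner_diff_left inner_diff_right inner_commute)
  have swap: "?P j i (a $ j - a $ i) = - ?P i j (a $ i - a $ j)" for a :: "real^2^'n" and i j
    using pair_force_deriv_minus[of "x $ i - x $ j" "a $ i - a $ j"] by simp
  have "2 * (force_deriv x a \<bullet> b) = (\<Sum>i\<in>UNIV. \<Sum>j\<in>UNIV. ?P i j (a $ i - a $ j) \<bullet> (b $ i - b $ j))"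
    for a b
  proof -
    have "force_deriv x a \<bullet> b = (\<Sum>i\<in>UNIV. \<Sum>j\<in>UNIV. ?P i j (a $ i - a $ j) \<bullet> b $ i)"
      by (simp add: force_deriv_def inner_vec_def[of _ b] inner_sum_left)
    moreover have "(\<Sum>i\<in>UNIV. \<Sum>j\<in>UNIV. ?P i j (a $ i - a $ j) \<bullet> b $ i) =
        (\<Sum>i\<in>UNIV. \<Sum>j\<in>UNIV. ?P j i (a $ j - a $ i) \<bullet> b $ j)"
      by (rule sum.swap)
    moreover have "\<dots> = (\<Sum>i\<in>UNIV. \<Sum>j\<in>UNIV. - (?P i j (a $ i - a $ j) \<bullet> b $ j))"
      by (intro sum.cong refl) (subst swap, rule inner_minus_left)
    ultimately show ?thesis
      by (simp add: inner_diff_right sum_subtractf sum_negf)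
  qed
  from this[of h k] this[of k h]
  have "2 * (force_deriv x h \<bullet> k) = 2 * (force_deriv x k \<bullet> h)"
    by (simp only:) (intro sum.cong refl pair)
  then show ?thesis by (simp add: inner_commute)
qed

text \<open>By \<open>hessian_eq\<close>, row \<open>p\<close> of the Hessian is
  \<open>force_deriv x\<close> applied to the unit vector of \<open>p\<close>; symmetry moves the
  operator onto \<open>Y\<close>.\<close>

lemma hessian_mult:
  assumes "inj (($) x)"
  shows "(\<Sum>q\<in>UNIV. hessian schwarzschild_potential x $ p $ q * Y $ fst q $ snd q) =
    force_deriv x Y $ fst p $ snd p"
proof -
  let ?e = "axis (fst p) (axis (snd p) 1) :: real^2^4"
  have "hessian schwarzschild_potential x $ p $ q = force_deriv x ?e $ fst q $ snd q" for q
    using open_collision_free assms schwarzschild_potential_GDERIV force_has_derivative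
    by (intro hessian_eq[of "{x. inj (($) x)}"]) auto
  then have "(\<Sum>q\<in>UNIV. hessian schwarzschild_potential x $ p $ q * Y $ fst q $ snd q) =
      force_deriv x ?e \<bullet> Y"
    by (simp add: inner_vec_def sum.cartesian_product case_prod_beta)
  also have "\<dots> = force_deriv x Y \<bullet> ?e"
    by (metis force_deriv_symmetric inner_commute)
  finally show ?thesis by (simp add: inner_axis)
qed

section \<open>Rotations and relative equilibria\<close>

lemma J_mat_mult: "J_mat *v w = vector [w $ 2, - w $ 1]"
  by (simp add: J_mat_def vec_eq_iff forall_2 matrix_vector_mult_def sum_2)

text \<open>Euler's formula for the exponential of -\<open>\<theta>\<close> J, where J squares to
  minus the identity.\<close>

lemma rotation_mult: "rotation \<theta> *v w = cos \<theta> *\<^sub>R w - sin \<theta> *\<^sub>R (J_mat *v w)"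
  unfolding J_mat_mult
  by (simp add: rotation_def vec_eq_iff forall_2 matrix_vector_mult_def sum_2)

lemma J_mat_involution: "J_mat *v (J_mat *v w) = - w"
  by (simp add: J_mat_mult vec_eq_iff forall_2)

lemma inner_J_mat: "(J_mat *v w) \<bullet> w = 0"
  by (simp add: J_mat_mult inner_vec_def sum_2)

lemma norm_rotation: "norm (rotation \<theta> *v w) = norm w"
proof -
  have "(rotation \<theta> *v w) \<bullet> (rotation \<theta> *v w) = ((cos \<theta>)\<^sup>2 + (sin \<theta>)\<^sup>2) * (w \<bullet> w)"
    unfolding rotation_mult J_mat_mult inner_vec_def sum_2 vector_minus_component
      vector_scaleR_component vector_2 real_scaleR_def inner_real_def
    by algebra
  then show ?thesis by (simp add: norm_eq_sqrt_inner)
qed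

lemma pair_force_rotation: "pair_force (rotation \<theta> *v w) = rotation \<theta> *v pair_force w"
  by (simp add: pair_force_def norm_rotation matrix_vector_mult_scaleR)

text \<open>Pair forces are radial with a factor depending only on the distance, so they commute
  with rotations.\<close>

lemma force_rotation: "force (\<chi> i. rotation \<theta> *v x $ i) = (\<chi> i. rotation \<theta> *v force x $ i)"
  by (simp add: force_def matrix_vector_mult_diff_distrib[symmetric] pair_force_rotation vec_eq_iff
      linear_sum[OF matrix_vector_mul_linear])

lemma inj_rotation:
  assumes "inj (($) x)"
  shows "inj (($) (\<chi> i. rotation \<theta> *v x $ i))"
proof (rule injI)
  fix i j
  assume "(\<chi> i. rotation \<theta> *v x $ i) $ i = (\<chi> i. rotation \<theta> *v x $ i) $ j"
  then have "norm (rotation \<theta> *v (x $ i - x $ j)) = 0"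
    by (simp add: matrix_vector_mult_diff_distrib)
  then show "i = j"
    using assms by (simp add: norm_rotation inj_def)
qed

lemma has_vector_derivative_rotation:
  fixes z :: "real^2^'n"
  shows "((\<lambda>t. \<chi> i. rotation (\<omega> * t) *v z $ i) has_vector_derivative
           - \<omega> *\<^sub>R (\<chi> i. rotation (\<omega> * t) *v (J_mat *v z $ i))) (at t)"
proof -
  define Jz where "Jz = (\<chi> i. J_mat *v z $ i)"
  have "((\<lambda>t. cos (\<omega> * t) *\<^sub>R z - sin (\<omega> * t) *\<^sub>R Jz) has_vector_derivative
      - \<omega> *\<^sub>R (cos (\<omega> * t) *\<^sub>R Jz + sin (\<omega> * t) *\<^sub>R z)) (at t)"
    by (auto intro!: derivative_eq_intros simp: algebra_simps)
  also have "(\<lambda>t. cos (\<omega> * t) *\<^sub>R z - sin (\<omega> * t) *\<^sub>R Jz) = (\<lambda>t. \<chi> i. rotation (\<omega> * t) *v z $ i)"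
    by (simp add: Jz_def rotation_mult vec_eq_iff fun_eq_iff)
  also have "cos (\<omega> * t) *\<^sub>R Jz + sin (\<omega> * t) *\<^sub>R z = (\<chi> i. rotation (\<omega> * t) *v (J_mat *v z $ i))"
    unfolding rotation_mult J_mat_involution by (simp add: Jz_def vec_eq_iff)
  finally show ?thesis .
qed

text \<open>Differentiating a uniform rotation twice gives \<open>- \<omega>\<^sup>2\<close> times
  the position, so the equation of motion becomes a condition on the gradient along the
  orbit.\<close>

lemma relative_equilibrium_iff:
  fixes z :: "real^2^'n"
  assumes "\<omega> > 0"
  shows "relative_equilibrium U z \<omega> \<longleftrightarrow>
    (\<forall>t. GDERIV U (\<chi> i. rotation (\<omega> * t) *v z $ i) :> - \<omega>\<^sup>2 *\<^sub>R (\<chi> i. rotation (\<omega> * t) *v z $ i))"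
proof -
  define Jz where "Jz = (\<chi> i. J_mat *v z $ i)"
  define q where "q = (\<lambda>t. \<chi> i. rotation (\<omega> * t) *v z $ i)"
  define v where "v = (\<lambda>t. - \<omega> *\<^sub>R (\<chi> i. rotation (\<omega> * t) *v Jz $ i))"
  have q: "(q has_vector_derivative v t) (at t)" for t
    using has_vector_derivative_rotation[of \<omega> z t] by (simp add: q_def v_def Jz_def)
  have v: "(v has_vector_derivative - \<omega>\<^sup>2 *\<^sub>R q t) (at t)" for t
  proof -
    have "(v has_vector_derivative - \<omega> *\<^sub>R (- \<omega> *\<^sub>R (\<chi> i. rotation (\<omega> * t) *v (J_mat *v Jz $ i)))) (at t)"
      unfolding v_def
      by (intro bounded_linear.has_vector_derivative[OF bounded_linear_scaleR_right]
          has_vector_derivative_rotation)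
    also have "(\<chi> i. rotation (\<omega> * t) *v (J_mat *v Jz $ i)) = - q t"
      by (simp add: Jz_def J_mat_involution q_def vec_eq_iff rotation_mult
          linear_neg[OF matrix_vector_mul_linear])
    finally show ?thesis by (simp add: power2_eq_square)
  qed
  have "solves_motion U q \<longleftrightarrow> (\<forall>t. GDERIV U (q t) :> - \<omega>\<^sup>2 *\<^sub>R q t)"
  proof
    assume "solves_motion U q"
    then obtain v' a where
      v': "\<And>t. (q has_vector_derivative v' t) (at t)" and
      a: "\<And>t. (v' has_vector_derivative a t) (at t)" and
      grad: "\<And>t. GDERIV U (q t) :> a t"
      unfolding solves_motion_def by blast
    \<comment> \<open>Derivatives are unique, so the existentially quantified velocity and
      acceleration are the computed ones.\<close>
    have "v' = v"
      using v' q by (auto intro: vector_derivative_unique_at)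
    then have "a t = - \<omega>\<^sup>2 *\<^sub>R q t" for t
      using a v by (auto intro: vector_derivative_unique_at)
    with grad show "\<forall>t. GDERIV U (q t) :> - \<omega>\<^sup>2 *\<^sub>R q t" by metis
  next
    assume "\<forall>t. GDERIV U (q t) :> - \<omega>\<^sup>2 *\<^sub>R q t"
    then show "solves_motion U q"
      unfolding solves_motion_def using q v
      by (intro exI[of _ v] exI[of _ "\<lambda>t. - \<omega>\<^sup>2 *\<^sub>R q t"]) blast
  qed
  with assms show ?thesis
    by (simp add: relative_equilibrium_def q_def)
qed

lemma GDERIV_unique:
  assumes "GDERIV f x :> a" "GDERIV f x :> b"
  shows "a = b"
proof -
  have "(\<lambda>h. h \<bullet> a) = (\<lambda>h. h \<bullet> b)"
    using assms unfolding gderiv_def by (rule has_derivative_unique)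
  then show ?thesis
    by (metis inner_commute vector_eq_ldot)
qed

section \<open>The square configuration\<close>

lemma vector_4 [simp]:
  "(vector [a, b, c, d] :: 'a::zero^4) $ 1 = a"
  "(vector [a, b, c, d] :: 'a::zero^4) $ 2 = b"
  "(vector [a, b, c, d] :: 'a::zero^4) $ 3 = c"
  "(vector [a, b, c, d] :: 'a::zero^4) $ 4 = d"
  unfolding vector_def by simp_all

lemma inj_square: "inj (($) square_configuration)"
  by (simp add: inj_def square_configuration_def forall_4 vec_eq_iff forall_2)

text \<open>Each vertex has two neighbours at distance \<open>sqrt 2\<close>, which are opposite to
  each other, and one opposite vertex at distance 2. The two neighbour differences add up to twice
  the vertex, and the opposite difference is also twice the vertex. An arbitrary weight
  \<open>c\<close> serves both the force and its radial derivative.\<close>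

lemma square_weighted_sum:
  "(\<Sum>j\<in>UNIV. c (norm (square_configuration $ i - square_configuration $ j)) *\<^sub>R
      (square_configuration $ i - square_configuration $ j)) =
    (2 * c (sqrt 2) + 2 * c 2) *\<^sub>R square_configuration $ i"
proof -
  have "\<forall>i. (\<Sum>j\<in>UNIV. c (norm (square_configuration $ i - square_configuration $ j)) *\<^sub>R
      (square_configuration $ i - square_configuration $ j)) =
    (2 * c (sqrt 2) + 2 * c 2) *\<^sub>R square_configuration $ i"
    by (simp add: forall_4 sum_4 vec_eq_iff forall_2 square_configuration_def norm_eq_sqrt_inner
        inner_vec_def sum_2)
  then show ?thesis ..
qed

lemma sqrt_2_powers: "sqrt 2 ^ 3 = 2 * sqrt 2" "sqrt 2 ^ 5 = 4 * sqrt 2"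
  by (simp_all add: eval_nat_numeral)

lemma force_square:
  "force square_configuration = - (7 / 16 + 5 / (2 * sqrt 2)) *\<^sub>R square_configuration"
proof -
  have "2 * (- (1 / sqrt 2 ^ 3 + 3 / sqrt 2 ^ 5)) + 2 * (- (1 / 2 ^ 3 + 3 / 2 ^ 5)) =
      - (7 / 16 + 5 / (2 * sqrt 2))"
    by (simp add: sqrt_2_powers field_simps)
  then show ?thesis
    using square_weighted_sum[of "\<lambda>r. - (1 / r ^ 3 + 3 / r ^ 5)"]
    by (simp add: force_def pair_force_def vec_eq_iff)
qed

text \<open>Rotation equivariance carries \<open>force_square\<close> along the whole orbit: the
  gradient is always the same multiple of the position. Uniqueness of the gradient at time 0 then
  determines \<open>\<omega>\<^sup>2\<close>.\<close>

lemma relative_equilibrium_square_iff: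
  assumes "\<omega> > 0"
  shows "relative_equilibrium schwarzschild_potential square_configuration \<omega> \<longleftrightarrow>
    \<omega>\<^sup>2 = 7 / 16 + 5 / (2 * sqrt 2)"
proof -
  let ?q = "\<lambda>t. \<chi> i. rotation (\<omega> * t) *v square_configuration $ i"
  have grad: "GDERIV schwarzschild_potential (?q t) :> - (7 / 16 + 5 / (2 * sqrt 2)) *\<^sub>R ?q t" for t
  proof -
    have "force (?q t) = - (7 / 16 + 5 / (2 * sqrt 2)) *\<^sub>R ?q t"
      unfolding force_rotation force_square
      by (simp add: vec_eq_iff linear_neg[OF matrix_vector_mul_linear]
        matrix_vector_mult_scaleR del: minus_add_distrib)
    then show ?thesis
      using schwarzschild_potential_GDERIV[OF inj_rotation[OF inj_square]] by metis
  qed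
  \<comment> \<open>A nonzero position allows the two scalar factors to be compared.\<close>
  have "?q 0 \<noteq> 0"
    by (auto simp: vec_eq_iff rotation_mult square_configuration_def forall_4 forall_2)
  then show ?thesis
    unfolding relative_equilibrium_iff[OF assms]
    using grad GDERIV_unique[OF grad[of 0]]
    by (metis neg_equal_iff_equal scaleR_right_imp_eq)
qed

lemma force_deriv_square_radial:
  "force_deriv square_configuration square_configuration =
    (5 / 4 + 4 * sqrt 2) *\<^sub>R square_configuration"
proof -
  \<comment> \<open>Euler's relation for homogeneous functions: the two parts of
    \<open>pair_force\<close> have degrees -2 and -4, which gives the coefficients 2 and 3 * 4 =
    12.\<close>
  have pair: "pair_force_deriv w w = (2 / norm w ^ 3 + 12 / norm w ^ 5) *\<^sub>R w" for w :: "real^2"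
  proof (cases "w = 0")
    case False
    then have "(3 / norm w ^ 5 + 15 / norm w ^ 7) * (norm w)\<^sup>2 - (1 / norm w ^ 3 + 3 / norm w ^ 5) =
        2 / norm w ^ 3 + 12 / norm w ^ 5"
      by (simp add: field_simps eval_nat_numeral)
    then show ?thesis
      by (simp only: pair_force_deriv_def dot_square_norm scaleR_diff_left[symmetric])
  qed (simp add: pair_force_deriv_def)
  have "2 * (2 / sqrt 2 ^ 3 + 12 / sqrt 2 ^ 5) + 2 * (2 / 2 ^ 3 + 12 / 2 ^ 5) = 5 / 4 + 4 * sqrt 2"
    by (simp add: sqrt_2_powers field_simps)
  then show ?thesis
    using square_weighted_sum[of "\<lambda>r. 2 / r ^ 3 + 12 / r ^ 5"]
    by (simp add: force_deriv_def pair vec_eq_iff)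
qed

text \<open>Infinitesimal form of rotation equivariance. Directly: J w is orthogonal to w, so the
  rank-one part of \<open>pair_force_deriv\<close> vanishes and only the multiple of the identity
  acts.\<close>

lemma force_deriv_tangential:
  "force_deriv x (\<chi> i. J_mat *v x $ i) = (\<chi> i. J_mat *v force x $ i)"
proof -
  have "pair_force_deriv w (J_mat *v w) = J_mat *v pair_force w" for w
    by (simp add: pair_force_deriv_def pair_force_def inner_J_mat matrix_vector_mult_scaleR
        linear_neg[OF matrix_vector_mul_linear]
        del: minus_add_distrib)
  then show ?thesis
    by (simp add: force_deriv_def force_def vec_eq_iff matrix_vector_mult_diff_distrib[symmetric]
        linear_sum[OF matrix_vector_mul_linear])
qed

section \<open>Instability of the square\<close>

lemma linearly_unstable_square:
  assumes "\<omega>\<^sup>2 = 7 / 16 + 5 / (2 * sqrt 2)"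
  shows "linearly_unstable schwarzschild_potential square_configuration \<omega>"
proof -
  let ?z = square_configuration
  define \<mu> where "\<mu> = sqrt (sqrt 2 / 4 - 1 / 16)"
  define Jz where "Jz = (\<chi> i. J_mat *v ?z $ i)"
  \<comment> \<open>For a z + b Jz the Jz-component of the eigenvalue equation reads
    \<open>\<mu>\<close> b = 2 \<open>\<omega>\<close> a after division by \<open>\<mu>\<close>,
    which fixes this ratio of coefficients.\<close>
  define Y where "Y = \<mu> *\<^sub>R ?z + (2 * \<omega>) *\<^sub>R Jz"
  have \<mu>: "\<mu> > 0" "\<mu>\<^sup>2 = 5 / 4 + 4 * sqrt 2 - 3 * \<omega>\<^sup>2"
  proof -
    have "(1 / 4)\<^sup>2 < (2 :: real)"
      by (simp add: power2_eq_square)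
    then have "1 / 4 < sqrt 2"
      by (rule real_less_rsqrt)
    then show "\<mu> > 0" "\<mu>\<^sup>2 = 5 / 4 + 4 * sqrt 2 - 3 * \<omega>\<^sup>2"
      by (simp_all add: \<mu>_def assms field_simps)
  qed
  have JY: "J_mat *v Y $ i = \<mu> *\<^sub>R Jz $ i - (2 * \<omega>) *\<^sub>R ?z $ i" for i
    by (simp add: Y_def Jz_def matrix_vector_right_distrib matrix_vector_mult_scaleR J_mat_involution)
  \<comment> \<open>Linearity comes for free because \<open>force_deriv\<close> is a Frechet
    derivative at the collision-free square.\<close>
  interpret hess: bounded_linear "force_deriv ?z"
    using force_has_derivative[OF inj_square] by (rule has_derivative_bounded_linear)
  have "force_deriv ?z Y = \<mu> *\<^sub>R force_deriv ?z ?z + (2 * \<omega>) *\<^sub>R force_deriv ?z Jz"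
    by (simp add: Y_def hess.add hess.scaleR)
  also have "force_deriv ?z Jz = - \<omega>\<^sup>2 *\<^sub>R Jz"
    unfolding Jz_def force_deriv_tangential force_square assms
    by (simp add: vec_eq_iff linear_neg[OF matrix_vector_mul_linear]
        matrix_vector_mult_scaleR del: minus_add_distrib)
  finally have D: "force_deriv ?z Y $ i = (\<mu> * (5 / 4 + 4 * sqrt 2)) *\<^sub>R ?z $ i - (2 * \<omega> * \<omega>\<^sup>2) *\<^sub>R Jz $ i"
    for i
    by (simp add: force_deriv_square_radial)
  \<comment> \<open>The first vertex is (1, 0) and J maps it to (0, -1), so this entry equals
    \<open>\<mu>\<close>.\<close>
  have "Y $ 1 $ 1 \<noteq> 0"
    using \<mu> by (simp add: Y_def Jz_def J_mat_mult square_configuration_def)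
  then have "Y \<noteq> 0" by auto
  then have "is_eigenvalue (map_matrix complex_of_real (linearization schwarzschild_potential ?z \<omega>))
      (complex_of_real \<mu>)"
  proof (rule linearization_eigenvalue)
    show "\<mu>\<^sup>2 *\<^sub>R Y $ i = (2 * \<omega> * \<mu>) *\<^sub>R (J_mat *v Y $ i) + \<omega>\<^sup>2 *\<^sub>R Y $ i + force_deriv ?z Y $ i" for i
    proof -
      \<comment> \<open>This compares the coefficients of z; those of Jz agree identically by the
        choice of \<open>Y\<close>.\<close>
      have "\<mu>\<^sup>2 * \<mu> + 4 * \<omega>\<^sup>2 * \<mu> = (5 / 4 + 4 * sqrt 2 + \<omega>\<^sup>2) * \<mu>"
        unfolding \<mu>(2) by (simp add: algebra_simps)
      from arg_cong[OF this, of "\<lambda>c. c *\<^sub>R ?z $ i"] show ?thesis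
        unfolding JY D by (simp add: Y_def algebra_simps power2_eq_square)
    qed
  qed (rule hessian_mult[OF inj_square])
  with \<mu> show ?thesis
    unfolding linearly_unstable_def by (intro exI[of _ "complex_of_real \<mu>"]) simp
qed

theorem mainTheorem6:
  fixes \<omega> :: real
  assumes "\<omega> > 0"
  shows "(relative_equilibrium schwarzschild_potential square_configuration \<omega> \<longleftrightarrow>
            \<omega>\<^sup>2 = 7 / 16 + 5 / (2 * sqrt 2)) \<and>
         (relative_equilibrium schwarzschild_potential square_configuration \<omega> \<longrightarrow>
            linearly_unstable schwarzschild_potential square_configuration \<omega>)"
  using relative_equilibrium_square_iff[OF assms] linearly_unstable_square by blast

end
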